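(* Let $H$ and $E$ be ultrametric hierarchical clusterings of sets $X$ and $Y$ respectively. Then $$d_{\mathrm{CI}}(H,E) = 2\cdot d_{\mathrm{GH}}\big((X,\theta_H),(Y,\theta_E)\big).$$
   Context: A clustering of a set $X$ is a set of non-empty, pairwise disjoint subsets of $X$ (clusters). $\mathsf{C}(X)$ is the poset of clusterings of $X$, where $S\preceq T$ if every $A\in S$ is contained in some $B\in T$. A one-parameter hierarchical clustering (HC) of $X$ is an order-preserving map $H: I\to \mathsf{C}(X)$ with $I$ an interval of $\mathbb{R}$ or of $\mathbb{R}^{\mathrm{op}}$. For $I\subseteq\mathbb{R}$, the extension $\bar H:\mathbb{R}\to\mathsf{C}(X)$ is: $\bar H(r)=H(r)$ if $r\in I$; $\bar H(r)=\{X\}$ if $r\notin I$ and there is $p\in I$ with $p<r$; $\bar H(r)=\emptyset$ otherwise. Define $\theta_H: X\times X\to[-\infty,\infty]$ by $\theta_H(x,y)=\inf\{r\in\mathbb{R} : \exists C\in\bar H(r),\ x,y\in C\}$. $H: I\to\mathsf{C}(X)$ is an ultrametric hierarchical clustering if $I=[0,\infty)$; for all $x\in X$ there is $r_x>0$ such that for all $r\in[0,r_x)$ the clustering $H(r)$ contains the singleton cluster $\{x\}$; and there is $r\in[0,\infty)$ with $H(r)=\{X\}$. In this case $\theta_H$ is an ultrametric on $X$. A correspondence between $X$ and $Y$ is a subset $R\subseteq X\times Y$ whose projections $\pi_X:R\to X$, $\pi_Y:R\to Y$ are surjective. For a function $\psi:Y\to X$ and a clustering $S=\{C_i\}$ of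 $X$, $\psi^*(S)=\{\psi^{-1}(C_i)\}$, and $\psi^*(H)=\psi^*\circ H$. Two HCs $H,E$ of the same set are $\epsilon$-interleaved ($\epsilon\ge0$) if $\bar H(r)\preceq\bar E(r+\epsilon)$ and $\bar E(r)\preceq\bar H(r+\epsilon)$ for all $r\in\mathbb{R}$. HCs $H$ of $X$ and $E$ of $Y$ are $\epsilon$-interleaved with respect to $R$ if $\pi_X^*(H)$ and $\pi_Y^*(E)$ are $\epsilon$-interleaved as HCs of $R$. The correspondence-interleaving distance $d_{\mathrm{CI}}(H,E)$ is the infimum of all $\epsilon\ge 0$ such that $H,E$ are $\epsilon$-interleaved with respect to some correspondence $R$ between $X$ and $Y$. The Gromov--Hausdorff distance is $d_{\mathrm{GH}}(M,N)=\inf_{i,j} d_{\mathrm{H}}^Z(i(M),j(N))$ over all isometric embeddings $i:M\to Z$, $j:N\to Z$ into a common metric space $Z$, where $d_{\mathrm{H}}^Z(A,B)=\inf\{\epsilon>0 : A\subseteq B^\epsilon,\ B\subseteq A^\epsilon\}$ and $W^\epsilon=\{z\in Z:\exists w\in W,\ d_Z(z,w)<\epsilon\}$. (This formula is used for the bounded metric spaces $(X,\theta_H)$, $(Y,\theta_E)$, compact or not.) *)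

theory Defs
  imports "HOL-Analysis.Analysis"
begin

text \<open>Unlike a partition, a clustering of \<open>X\<close> need not cover \<open>X\<close>; so \<open>partition_on\<close> and \<open>refines\<close>
  from the library do not apply.\<close>

definition clusterings :: "'a set \<Rightarrow> 'a set set set" where
  "clusterings X = {S. (\<forall>C\<in>S. C \<noteq> {} \<and> C \<subseteq> X) \<and> disjoint S}"

definition cluster_le :: "'a set set \<Rightarrow> 'a set set \<Rightarrow> bool" (infix "\<preceq>" 50) where
  "S \<preceq> T \<longleftrightarrow> (\<forall>A\<in>S. \<exists>B\<in>T. A \<subseteq> B)"

text \<open>A hierarchical clustering \<open>I \<rightarrow> C(X)\<close> is given by its index interval \<open>I\<close> and a function \<open>H\<close>
  whose values outside \<open>I\<close> are irrelevant. Only intervals of the real line with its usual order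
  occur below (not those with the opposite order), because an ultrametric hierarchical clustering
  is indexed by \<open>{0..}\<close>.\<close>

definition hierarchical_clustering :: "'a set \<Rightarrow> real set \<Rightarrow> (real \<Rightarrow> 'a set set) \<Rightarrow> bool" where
  "hierarchical_clustering X I H \<longleftrightarrow>
     is_interval I \<and> H \<in> I \<rightarrow> clusterings X \<and> monotone_on I (\<le>) (\<preceq>) H"

definition hc_extend ::
    "'a set \<Rightarrow> real set \<Rightarrow> (real \<Rightarrow> 'a set set) \<Rightarrow> real \<Rightarrow> 'a set set" where
  "hc_extend X I H r =
     (if r \<in> I then H r else if \<exists>p\<in>I. p < r then {X} else {})"

definition theta ::
    "'a set \<Rightarrow> real set \<Rightarrow> (real \<Rightarrow> 'a set set) \<Rightarrow> 'a \<Rightarrow> 'a \<Rightarrow> ereal" where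
  "theta X I H x y = Inf {ereal r |r. \<exists>C\<in>hc_extend X I H r. x \<in> C \<and> y \<in> C}"

definition ultrametric_hc :: "'a set \<Rightarrow> real set \<Rightarrow> (real \<Rightarrow> 'a set set) \<Rightarrow> bool" where
  "ultrametric_hc X I H \<longleftrightarrow>
     hierarchical_clustering X I H \<and> I = {0..} \<and>
     (\<forall>x\<in>X. \<exists>r\<^sub>x>0. \<forall>r\<in>{0..<r\<^sub>x}. {x} \<in> H r) \<and>
     (\<exists>r\<in>{0..}. H r = {X})"

definition correspondence :: "'a set \<Rightarrow> 'b set \<Rightarrow> ('a \<times> 'b) set \<Rightarrow> bool" where
  "correspondence X Y R \<longleftrightarrow> R \<subseteq> X \<times> Y \<and> fst ` R = X \<and> snd ` R = Y"

text \<open>The pullback along a function \<open>\<psi>\<close> with domain \<open>D\<close>.\<close>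

definition pullback :: "'b set \<Rightarrow> ('b \<Rightarrow> 'a) \<Rightarrow> 'a set set \<Rightarrow> 'b set set" where
  "pullback D \<psi> S = (\<lambda>C. \<psi> -` C \<inter> D) ` S"

definition interleaved ::
    "'a set \<Rightarrow> real set \<Rightarrow> (real \<Rightarrow> 'a set set) \<Rightarrow> real set \<Rightarrow> (real \<Rightarrow> 'a set set)
      \<Rightarrow> real \<Rightarrow> bool" where
  "interleaved X I H J E \<epsilon> \<longleftrightarrow>
     (\<forall>r. hc_extend X I H r \<preceq> hc_extend X J E (r + \<epsilon>) \<and>
          hc_extend X J E r \<preceq> hc_extend X I H (r + \<epsilon>))"

definition interleaved_wrt ::
    "('a \<times> 'b) set \<Rightarrow> real set \<Rightarrow> (real \<Rightarrow> 'a set set) \<Rightarrow> real set \<Rightarrow> (real \<Rightarrow> 'b set set)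
      \<Rightarrow> real \<Rightarrow> bool" where
  "interleaved_wrt R I H J E \<epsilon> \<longleftrightarrow>
     interleaved R I (pullback R fst \<circ> H) J (pullback R snd \<circ> E) \<epsilon>"

definition d_CI ::
    "'a set \<Rightarrow> real set \<Rightarrow> (real \<Rightarrow> 'a set set) \<Rightarrow>
     'b set \<Rightarrow> real set \<Rightarrow> (real \<Rightarrow> 'b set set) \<Rightarrow> ereal" where
  "d_CI X I H Y J E =
     Inf {ereal \<epsilon> |\<epsilon>. \<epsilon> \<ge> 0 \<and> (\<exists>R. correspondence X Y R \<and> interleaved_wrt R I H J E \<epsilon>)}"

definition thickening :: "'c set \<Rightarrow> ('c \<Rightarrow> 'c \<Rightarrow> real) \<Rightarrow> 'c set \<Rightarrow> real \<Rightarrow> 'c set" where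
  "thickening Z d W \<epsilon> = {z\<in>Z. \<exists>w\<in>W. d z w < \<epsilon>}"

definition hausdorff_dist ::
    "'c set \<Rightarrow> ('c \<Rightarrow> 'c \<Rightarrow> real) \<Rightarrow> 'c set \<Rightarrow> 'c set \<Rightarrow> ereal" where
  "hausdorff_dist Z d A B =
     Inf {ereal \<epsilon> |\<epsilon>. \<epsilon> > 0 \<and> A \<subseteq> thickening Z d B \<epsilon> \<and> B \<subseteq> thickening Z d A \<epsilon>}"

definition isometric_embedding ::
    "'a set \<Rightarrow> ('a \<Rightarrow> 'a \<Rightarrow> real) \<Rightarrow> 'c set \<Rightarrow> ('c \<Rightarrow> 'c \<Rightarrow> real) \<Rightarrow> ('a \<Rightarrow> 'c) \<Rightarrow> bool" where
  "isometric_embedding M dM Z d i \<longleftrightarrow>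
     i \<in> M \<rightarrow> Z \<and> (\<forall>x\<in>M. \<forall>y\<in>M. d (i x) (i y) = dM x y)"

text \<open>The infimum ranges over all metric spaces \<open>Z\<close> whose points lie in the type \<open>'a + 'b\<close>, and the
  two embeddings are arbitrary (their images may overlap). Nothing is lost by fixing this type: the
  Hausdorff distance only depends on the union of the two images, which can always be copied into
  \<open>'a + 'b\<close>. The lemma \<open>d_GH_le\<close> below proves that metric spaces over any other type do not give
  smaller values.\<close>

definition d_GH ::
    "'a set \<Rightarrow> ('a \<Rightarrow> 'a \<Rightarrow> real) \<Rightarrow> 'b set \<Rightarrow> ('b \<Rightarrow> 'b \<Rightarrow> real) \<Rightarrow> ereal" where
  "d_GH M dM N dN =
     Inf {hausdorff_dist Z d (i ` M) (j ` N) |(Z :: ('a + 'b) set) d i j.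
            Metric_space Z d \<and> isometric_embedding M dM Z d i \<and> isometric_embedding N dN Z d j}"

lemma d_GH_le:
  fixes Z :: "'c set" and M :: "'a set" and N :: "'b set"
  assumes "Metric_space Z d" "isometric_embedding M dM Z d i" "isometric_embedding N dN Z d j"
  shows "d_GH M dM N dN \<le> hausdorff_dist Z d (i ` M) (j ` N)"
proof -
  interpret Metric_space Z d by fact
  define U where "U = i ` M \<union> j ` N"
  define g :: "'c \<Rightarrow> 'a + 'b"
    where "g u = (if u \<in> i ` M then Inl (inv_into M i u) else Inr (inv_into N j u))" for u
  define h where "h = inv_into U g"
  define d' where "d' p q = d (h p) (h q)" for p q
  have U: "U \<subseteq> Z"
    using assms(2,3) by (auto simp: U_def isometric_embedding_def)
  have "inj_on g U"
    by (auto simp: inj_on_def g_def U_def split: if_splits) (metis f_inv_into_f image_eqI)+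
  then have h: "h (g u) = u" if "u \<in> U" for u
    using that by (simp add: h_def)
  have d': "d' (g u) (g v) = d u v" if "u \<in> U" "v \<in> U" for u v
    using that by (simp add: d'_def h)
  have ms: "Metric_space (g ` U) d'"
  proof
    show "0 \<le> d' x y" and "d' x y = d' y x" for x y
      by (auto simp: d'_def commute)
    show "(d' x y = 0) = (x = y)" if "x \<in> g ` U" "y \<in> g ` U" for x y
    proof -
      obtain u v where uv: "u \<in> U" "v \<in> U" "x = g u" "y = g v"
        using \<open>x \<in> g ` U\<close> \<open>y \<in> g ` U\<close> by blast
      then have "u \<in> Z" "v \<in> Z" "(x = y) = (u = v)"
        using U h by (blast, blast, metis)
      then show ?thesis
        by (simp add: uv d')
    qed
    show "d' x z \<le> d' x y + d' y z" if "x \<in> g ` U" "y \<in> g ` U" "z \<in> g ` U" for x y z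
      using that U by (auto simp: d' intro!: triangle)
  qed
  have emb: "isometric_embedding M dM (g ` U) d' (g \<circ> i)"
            "isometric_embedding N dN (g ` U) d' (g \<circ> j)"
    using assms(2,3) by (auto simp: isometric_embedding_def d' U_def)
  have th: "(g ` A \<subseteq> thickening (g ` U) d' (g ` B) \<epsilon>) = (A \<subseteq> thickening Z d B \<epsilon>)"
    if "A \<subseteq> U" "B \<subseteq> U" for A B \<epsilon>
  proof -
    have "(\<exists>w\<in>B. d' (g z) (g w) < \<epsilon>) = (\<exists>w\<in>B. d z w < \<epsilon>)" if "z \<in> A" for z
      using \<open>A \<subseteq> U\<close> \<open>B \<subseteq> U\<close> that by (auto simp: d' subset_eq)
    then show ?thesis
      using that U by (auto simp: thickening_def subset_eq)
  qed
  have ij: "i ` M \<subseteq> U" "j ` N \<subseteq> U"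
    by (auto simp: U_def)
  have "hausdorff_dist (g ` U) d' ((g \<circ> i) ` M) ((g \<circ> j) ` N) = hausdorff_dist Z d (i ` M) (j ` N)"
    unfolding hausdorff_dist_def image_comp[symmetric] th[OF ij] th[OF ij(2,1)] ..
  then show ?thesis
    unfolding d_GH_def by (intro Inf_lower) (use ms emb in force)
qed

definition theta_metric ::
    "'a set \<Rightarrow> real set \<Rightarrow> (real \<Rightarrow> 'a set set) \<Rightarrow> 'a \<Rightarrow> 'a \<Rightarrow> real" where
  "theta_metric X I H x y = real_of_ereal (theta X I H x y)"

lemma clusterings_eqI:
  assumes "S \<in> clusterings X" "C \<in> S" "D \<in> S" "x \<in> C \<inter> D"
  shows "C = D"
  using assms disjointD[of S C D] unfolding clusterings_def by fastforce

lemma theta_less_iff: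
  "theta X I H x y < c \<longleftrightarrow> (\<exists>r. ereal r < c \<and> (\<exists>C\<in>hc_extend X I H r. x \<in> C \<and> y \<in> C))"
  unfolding theta_def Inf_less_iff by blast

lemma theta_nonneg:
  assumes "ultrametric_hc X I H"
  shows "0 \<le> theta X I H x y"
proof (rule ccontr)
  assume "\<not> ?thesis"
  then obtain r where "r < 0" "hc_extend X I H r \<noteq> {}"
    by (auto simp: not_le theta_less_iff zero_ereal_def)
  with assms show False
    by (auto simp: ultrametric_hc_def hc_extend_def split: if_splits)
qed

lemma ereal_theta_metric:
  assumes "ultrametric_hc X I H" "x \<in> X" "y \<in> X"
  shows "ereal (theta_metric X I H x y) = theta X I H x y"
proof -
  obtain r where r: "r \<ge> 0" "H r = {X}"
    using assms by (auto simp: ultrametric_hc_def)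
  then have "theta X I H x y < ereal (r + 1)"
    using assms unfolding theta_less_iff
    by (intro exI[of _ r]) (auto simp: ultrametric_hc_def hc_extend_def)
  then have "\<bar>theta X I H x y\<bar> \<noteq> \<infinity>"
    using theta_nonneg[OF assms(1), of x y] by auto
  then show ?thesis
    by (simp add: theta_metric_def ereal_real)
qed

lemma theta_ultra:
  assumes "ultrametric_hc X I H"
  shows "theta X I H x z \<le> max (theta X I H x y) (theta X I H y z)"
proof (rule dense_ge)
  fix c assume "max (theta X I H x y) (theta X I H y z) < c"
  then obtain r C s D where
    rs: "ereal r < c" "C \<in> hc_extend X I H r" "x \<in> C" "y \<in> C"
        "ereal s < c" "D \<in> hc_extend X I H s" "y \<in> D" "z \<in> D"
    by (auto simp: theta_less_iff)
  have I: "I = {0..}" and mono: "\<And>a b. 0 \<le> a \<Longrightarrow> a \<le> b \<Longrightarrow> H a \<preceq> H b"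
    and cl: "\<And>a. 0 \<le> a \<Longrightarrow> H a \<in> clusterings X"
    using assms by (auto simp: ultrametric_hc_def hierarchical_clustering_def monotone_on_def)
  have nn: "0 \<le> r" "0 \<le> s" and CD: "C \<in> H r" "D \<in> H s"
    using rs by (auto simp: hc_extend_def I split: if_splits)
  define t where "t = max r s"
  have t: "0 \<le> t" "ereal t < c" "r \<le> t" "s \<le> t"
    using rs nn by (auto simp: t_def max_def)
  obtain C' D' where CD': "C' \<in> H t" "C \<subseteq> C'" "D' \<in> H t" "D \<subseteq> D'"
    using mono[OF nn(1) t(3)] mono[OF nn(2) t(4)] CD unfolding cluster_le_def by blast
  have "y \<in> C' \<inter> D'"
    using CD' rs by blast
  then have "C' = D'"
    by (rule clusterings_eqI[OF cl[OF t(1)] CD'(1,3)])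
  then have "theta X I H x z < c"
    using CD' rs t \<open>C' = D'\<close> unfolding theta_less_iff by (intro exI[of _ t]) (auto simp: hc_extend_def I)
  then show "theta X I H x z \<le> c" by simp
qed

text \<open>The value of \<open>theta\<close> is finite on \<open>X\<close> by \<open>ereal_theta_metric\<close>, so \<open>theta_metric\<close> is the
  same function seen as real-valued.\<close>

lemma Metric_space_theta:
  assumes "ultrametric_hc X I H"
  shows "Metric_space X (theta_metric X I H)"
proof
  let ?t = "theta_metric X I H"
  show nn: "0 \<le> ?t x y" for x y
    by (simp add: theta_metric_def real_of_ereal_pos theta_nonneg[OF assms])
  show "?t x y = ?t y x" for x y
    by (simp add: theta_metric_def theta_def conj_commute)
  show "?t x z \<le> ?t x y + ?t y z" if "x \<in> X" "y \<in> X" "z \<in> X" for x y z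
  proof -
    have "ereal (?t x z) \<le> max (ereal (?t x y)) (ereal (?t y z))"
      using theta_ultra[OF assms] that by (simp add: ereal_theta_metric[OF assms])
    then show ?thesis
      using nn[of x y] nn[of y z] by (auto simp: le_max_iff_disj)
  qed
  show "(?t x y = 0) = (x = y)" if "x \<in> X" "y \<in> X" for x y
  proof
    from assms that obtain R where I: "I = {0..}" and R: "R > 0" "\<And>r. r \<in> {0..<R} \<Longrightarrow> {x} \<in> H r"
      unfolding ultrametric_hc_def by meson
    {
      assume "?t x y = 0"
      then have "theta X I H x y < ereal R"
        using ereal_theta_metric[OF assms that] R by (metis ereal_less(2) zero_ereal_def)
      then obtain r C where C: "r < R" "C \<in> hc_extend X I H r" "x \<in> C" "y \<in> C"
        by (auto simp: theta_less_iff)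
      then have r: "0 \<le> r" "C \<in> H r"
        by (auto simp: hc_extend_def I split: if_splits)
      moreover have "H r \<in> clusterings X"
        using assms r by (auto simp: ultrametric_hc_def hierarchical_clustering_def)
      moreover have "{x} \<in> H r" using R C r by auto
      ultimately have "C = {x}"
        using C clusterings_eqI[of "H r" X C "{x}" x] by simp
      then show "x = y" using C by auto
    }
    assume "x = y"
    have "theta X I H x x \<le> ereal 0"
      unfolding theta_def using R by (intro Inf_lower) (force simp: hc_extend_def I)
    then have "theta X I H x x = 0"
      using theta_nonneg[OF assms, of x x] by (simp add: zero_ereal_def)
    then show "?t x y = 0"
      using \<open>x = y\<close> by (simp add: theta_metric_def)
  qed
qed

end

theory Submission
  imports Defs
begin

text \<open>Both sides are governed by the distortion of correspondences: an \<open>\<epsilon>\<close>-interleaving with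
  respect to \<open>R\<close> forces \<open>\<bar>\<theta>\<^sub>H(x,x') - \<theta>\<^sub>E(y,y')\<bar> \<le> \<epsilon>\<close> on \<open>R\<close>, and the strict inequality gives an
  \<open>\<epsilon>\<close>-interleaving. A correspondence of distortion at most \<open>\<epsilon>\<close> extends the two metrics to the
  disjoint union, with corresponding points at distance at most \<open>\<delta>\<close> for any \<open>\<delta> > \<epsilon>/2\<close>; conversely,
  the pairs at distance less than \<open>\<delta>\<close> in a common metric space form a correspondence of
  distortion less than \<open>2\<delta>\<close> as soon as the Hausdorff distance is less than \<open>\<delta>\<close>.\<close>

section \<open>Ultrametric hierarchical clusterings\<close>

lemma ultrametric_hcD:
  assumes "ultrametric_hc X I H"
  shows "I = {0..}" "0 \<le> r \<Longrightarrow> H r \<in> clusterings X" "0 \<le> r \<Longrightarrow> r \<le> s \<Longrightarrow> H r \<preceq> H s"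
  using assms by (auto simp: ultrametric_hc_def hierarchical_clustering_def monotone_on_def)

lemma theta_metric_le:
  assumes "ultrametric_hc X I H" "0 \<le> r" "C \<in> H r" "x \<in> C" "y \<in> C"
  shows "theta_metric X I H x y \<le> r"
proof -
  have "x \<in> X" "y \<in> X"
    using ultrametric_hcD(2)[of X I H r] assms by (auto simp: clusterings_def)
  moreover have "theta X I H x y \<le> ereal r"
    unfolding theta_def
    by (intro Inf_lower) (use assms ultrametric_hcD(1)[OF assms(1)] in \<open>auto simp: hc_extend_def\<close>)
  ultimately show ?thesis
    using ereal_theta_metric[OF assms(1)] by (metis ereal_less_eq(3))
qed

text \<open>The infimum defining \<open>theta\<close> need not be attained, hence the strict
  hypothesis: some index below \<open>r\<close> has a cluster with both points, and monotonicity of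
  \<open>H\<close> carries it up to \<open>r\<close>.\<close>

lemma theta_metric_less_imp_cluster:
  assumes "ultrametric_hc X I H" "x \<in> X" "y \<in> X" "theta_metric X I H x y < r"
  obtains C where "0 \<le> r" "C \<in> H r" "x \<in> C" "y \<in> C"
proof -
  have "theta X I H x y < ereal r"
    using assms by (simp flip: ereal_theta_metric)
  then obtain s C where s: "s < r" "C \<in> hc_extend X I H s" "x \<in> C" "y \<in> C"
    by (auto simp: theta_less_iff)
  then have "0 \<le> s" "C \<in> H s"
    by (auto simp: hc_extend_def ultrametric_hcD(1)[OF assms(1)] split: if_splits)
  with s show ?thesis
    using that ultrametric_hcD(3)[OF assms(1), of s r] unfolding cluster_le_def by fastforce
qed

section \<open>Interleaving of pullbacks in terms of the metrics\<close>

lemma hc_extend_pullback: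
  assumes "ultrametric_hc X I H"
  shows "hc_extend D I (pullback D f \<circ> H) r = (if 0 \<le> r then pullback D f (H r) else {})"
  using ultrametric_hcD(1)[OF assms] by (auto simp: hc_extend_def)

text \<open>Half of an interleaving, with general maps so that it serves both directions with
  \<open>fst\<close> and \<open>snd\<close> swapped. Points of one cluster at \<open>r\<close> are
  at distance at most \<open>r\<close>, so their partners are strictly closer than
  \<open>r + \<epsilon>\<close>, which forces a common cluster.\<close>

lemma pullback_cluster_le:
  assumes H: "ultrametric_hc X I H" and E: "ultrametric_hc Y J E"
    and f: "f ` D = X" and g: "g ` D = Y"
    and less: "\<And>p q. p \<in> D \<Longrightarrow> q \<in> D \<Longrightarrow>
      theta_metric Y J E (g p) (g q) < theta_metric X I H (f p) (f q) + \<epsilon>"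
  shows "hc_extend D I (pullback D f \<circ> H) r \<preceq> hc_extend D J (pullback D g \<circ> E) (r + \<epsilon>)"
  unfolding cluster_le_def
proof
  fix A assume "A \<in> hc_extend D I (pullback D f \<circ> H) r"
  then obtain C where r: "0 \<le> r" and C: "C \<in> H r" and A: "A = f -` C \<inter> D"
    by (auto simp: hc_extend_pullback[OF H] pullback_def split: if_splits)
  have "C \<noteq> {}" "C \<subseteq> X"
    using ultrametric_hcD(2)[OF H r] C by (auto simp: clusterings_def)
  then obtain p where p: "p \<in> D" "f p \<in> C"
    using f by blast
  have *: "\<exists>B\<in>E (r + \<epsilon>). g p \<in> B \<and> g q \<in> B \<and> 0 \<le> r + \<epsilon>" if "q \<in> A" for q
  proof -
    have "theta_metric Y J E (g p) (g q) < r + \<epsilon>"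
      using less[of p q] theta_metric_le[OF H r C, of "f p" "f q"] p that A by force
    moreover have "g p \<in> Y" "g q \<in> Y"
      using g p that A by auto
    ultimately show ?thesis
      using theta_metric_less_imp_cluster[OF E] by metis
  qed
  \<comment> \<open>The case \<open>q = p\<close> fixes \<open>B\<close>; by disjointness every
    other cluster from \<open>*\<close> equals it, since all contain \<open>g p\<close>.\<close>
  then obtain B where B: "B \<in> E (r + \<epsilon>)" "g p \<in> B" "0 \<le> r + \<epsilon>"
    using p A by blast
  have "g q \<in> B" if "q \<in> A" for q
    using *[OF that] B clusterings_eqI[OF ultrametric_hcD(2)[OF E B(3)]] by blast
  with B show "\<exists>B\<in>hc_extend D J (pullback D g \<circ> E) (r + \<epsilon>). A \<subseteq> B"
    by (auto simp: hc_extend_pullback[OF E] pullback_def A intro!: bexI[of _ B])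
qed

text \<open>A cluster joining \<open>f p\<close> and \<open>f q\<close> pulls back to one containing
  \<open>p\<close> and \<open>q\<close>, which the inclusion places inside a pulled-back cluster of
  \<open>E\<close>. Such a cluster is only available strictly above the distance, hence the slack
  \<open>e\<close>.\<close>

lemma theta_metric_le_of_pullback_cluster_le:
  assumes H: "ultrametric_hc X I H" and E: "ultrametric_hc Y J E"
    and le: "\<And>r. hc_extend D I (pullback D f \<circ> H) r \<preceq> hc_extend D J (pullback D g \<circ> E) (r + \<epsilon>)"
    and p: "p \<in> D" "f p \<in> X" and q: "q \<in> D" "f q \<in> X"
  shows "theta_metric Y J E (g p) (g q) \<le> theta_metric X I H (f p) (f q) + \<epsilon>"
proof (rule field_le_epsilon)
  fix e :: real assume "0 < e"
  define r where "r = theta_metric X I H (f p) (f q) + e"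
  obtain C where C: "0 \<le> r" "C \<in> H r" "f p \<in> C" "f q \<in> C"
    using theta_metric_less_imp_cluster[OF H, of "f p" "f q" r] p q \<open>0 < e\<close>
    by (auto simp: r_def)
  then have "f -` C \<inter> D \<in> hc_extend D I (pullback D f \<circ> H) r"
    by (auto simp: hc_extend_pullback[OF H] pullback_def)
  then obtain A where "A \<in> hc_extend D J (pullback D g \<circ> E) (r + \<epsilon>)" "f -` C \<inter> D \<subseteq> A"
    using le[of r] unfolding cluster_le_def by blast
  then obtain B where "0 \<le> r + \<epsilon>" "B \<in> E (r + \<epsilon>)" "f -` C \<inter> D \<subseteq> g -` B \<inter> D"
    by (auto simp: hc_extend_pullback[OF E] pullback_def split: if_splits)
  then have "theta_metric Y J E (g p) (g q) \<le> r + \<epsilon>"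
    using C p q by (intro theta_metric_le[OF E]) auto
  then show "theta_metric Y J E (g p) (g q) \<le> theta_metric X I H (f p) (f q) + \<epsilon> + e"
    by (simp add: r_def)
qed

section \<open>Correspondences and the Gromov--Hausdorff distance\<close>

definition distortion_le ::
    "('a \<times> 'b) set \<Rightarrow> ('a \<Rightarrow> 'a \<Rightarrow> real) \<Rightarrow> ('b \<Rightarrow> 'b \<Rightarrow> real) \<Rightarrow> real \<Rightarrow> bool" where
  "distortion_le R dM dN \<epsilon> \<longleftrightarrow>
     (\<forall>p\<in>R. \<forall>q\<in>R. \<bar>dM (fst p) (fst q) - dN (snd p) (snd q)\<bar> \<le> \<epsilon>)"

text \<open>The \<open>max 0\<close> only matters for \<open>R = {}\<close>, where the infimum is unspecified, while
  \<open>Metric_space\<close> demands nonnegativity everywhere.\<close>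

definition glue_dist ::
    "('a \<times> 'b) set \<Rightarrow> ('a \<Rightarrow> 'a \<Rightarrow> real) \<Rightarrow> ('b \<Rightarrow> 'b \<Rightarrow> real) \<Rightarrow> real \<Rightarrow> 'a \<Rightarrow> 'b \<Rightarrow> real" where
  "glue_dist R dM dN \<delta> x y = max 0 (INF p\<in>R. dM x (fst p) + \<delta> + dN (snd p) y)"

text \<open>Cross distances are, up to the clipping at 0, infimal lengths of routes that jump once
  between the copies, along a pair of \<open>R\<close>, at cost \<delta>.\<close>

fun glue_metric ::
    "('a \<times> 'b) set \<Rightarrow> ('a \<Rightarrow> 'a \<Rightarrow> real) \<Rightarrow> ('b \<Rightarrow> 'b \<Rightarrow> real) \<Rightarrow> real \<Rightarrow> 'a + 'b \<Rightarrow> 'a + 'b \<Rightarrow> real" where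
  "glue_metric R dM dN \<delta> (Inl x) (Inl x') = dM x x'"
| "glue_metric R dM dN \<delta> (Inr y) (Inr y') = dN y y'"
| "glue_metric R dM dN \<delta> (Inl x) (Inr y) = glue_dist R dM dN \<delta> x y"
| "glue_metric R dM dN \<delta> (Inr y) (Inl x) = glue_dist R dM dN \<delta> x y"

section \<open>The glued metric on the disjoint union\<close>

context
  fixes M :: "'a set" and dM and N :: "'b set" and dN and R and \<epsilon> \<delta> :: real
  assumes M: "Metric_space M dM" and N: "Metric_space N dN"
    and R: "correspondence M N R" and dis: "distortion_le R dM dN \<epsilon>"
    and \<delta>: "0 < \<delta>" "\<epsilon> \<le> 2 * \<delta>"
begin

interpretation M: Metric_space M dM by (fact M)
interpretation N: Metric_space N dN by (fact N)

lemma in_correspondence: "p \<in> R \<Longrightarrow> fst p \<in> M \<and> snd p \<in> N"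
  using R by (auto simp: correspondence_def)

lemma glue_dist_le: "p \<in> R \<Longrightarrow> glue_dist R dM dN \<delta> x y \<le> dM x (fst p) + \<delta> + dN (snd p) y"
  unfolding glue_dist_def
  \<comment> \<open>All terms of the infimum are nonnegative, so the family is bounded below and the
    clipping at 0 preserves the upper bound.\<close>
  by (intro max.boundedI cINF_lower bdd_belowI2[where m = 0])
    (use \<delta> in \<open>auto intro!: add_nonneg_nonneg\<close>)

lemma le_glue_dist:
  assumes "x \<in> M" "\<And>p. p \<in> R \<Longrightarrow> c \<le> dM x (fst p) + \<delta> + dN (snd p) y"
  shows "c \<le> glue_dist R dM dN \<delta> x y"
proof -
  have "R \<noteq> {}"
    using R assms(1) by (auto simp: correspondence_def)
  then show ?thesis
    unfolding glue_dist_def by (intro max.coboundedI2 cINF_greatest assms(2))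
qed

lemma glue_dist_pos: "x \<in> M \<Longrightarrow> 0 < glue_dist R dM dN \<delta> x y"
  using \<delta>(1) le_glue_dist[of x \<delta> y] by fastforce

text \<open>Moving \<open>dM x x'\<close> to the left leaves a lone infimum on the right, so each
  pair \<open>p\<close> can be treated separately by the triangle inequality in
  \<open>M\<close>.\<close>

lemma glue_dist_triangle_left:
  assumes "x \<in> M" "x' \<in> M"
  shows "glue_dist R dM dN \<delta> x y \<le> dM x x' + glue_dist R dM dN \<delta> x' y"
proof -
  have "glue_dist R dM dN \<delta> x y - dM x x' \<le> glue_dist R dM dN \<delta> x' y"
  proof (rule le_glue_dist[OF \<open>x' \<in> M\<close>])
    fix p assume "p \<in> R"
    then show "glue_dist R dM dN \<delta> x y - dM x x' \<le> dM x' (fst p) + \<delta> + dN (snd p) y"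
      using glue_dist_le[of p x y] M.triangle[of x x' "fst p"] assms in_correspondence[of p] by auto
  qed
  then show ?thesis by simp
qed

lemma glue_dist_triangle_right:
  assumes "x \<in> M" "y \<in> N" "y' \<in> N"
  shows "glue_dist R dM dN \<delta> x y \<le> glue_dist R dM dN \<delta> x y' + dN y' y"
proof -
  have "glue_dist R dM dN \<delta> x y - dN y' y \<le> glue_dist R dM dN \<delta> x y'"
  proof (rule le_glue_dist[OF \<open>x \<in> M\<close>])
    fix p assume "p \<in> R"
    then show "glue_dist R dM dN \<delta> x y - dN y' y \<le> dM x (fst p) + \<delta> + dN (snd p) y'"
      using glue_dist_le[of p x y] N.triangle[of "snd p" y' y] assms in_correspondence[of p] by auto
  qed
  then show ?thesis by simp
qed

text \<open>Here the distortion enters: a detour through \<open>N\<close> crosses along two pairs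
  \<open>p\<close> and \<open>q\<close> and pays \<open>2 * \<delta>\<close>, which covers the
  excess of at most \<epsilon> of \<open>dM (fst p) (fst q)\<close> over
  \<open>dN (snd p) (snd q)\<close>. The two infima are opened one after the other.\<close>

lemma dist_le_glue_dist_left:
  assumes "x \<in> M" "x' \<in> M" "y \<in> N"
  shows "dM x x' \<le> glue_dist R dM dN \<delta> x y + glue_dist R dM dN \<delta> x' y"
proof -
  have "dM x x' - glue_dist R dM dN \<delta> x' y \<le> glue_dist R dM dN \<delta> x y"
  proof (rule le_glue_dist[OF \<open>x \<in> M\<close>])
    fix p assume p: "p \<in> R"
    have "dM x x' - (dM x (fst p) + \<delta> + dN (snd p) y) \<le> glue_dist R dM dN \<delta> x' y"
    proof (rule le_glue_dist[OF \<open>x' \<in> M\<close>])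
      fix q assume q: "q \<in> R"
      have "dM x x' \<le> dM x (fst p) + dM (fst p) (fst q) + dM x' (fst q)"
        using M.triangle[of x "fst p" x'] M.triangle[of "fst p" "fst q" x'] M.commute[of x' "fst q"]
          assms in_correspondence[OF p] in_correspondence[OF q] by auto
      moreover have "dN (snd p) (snd q) \<le> dN (snd p) y + dN (snd q) y"
        using N.triangle[of "snd p" y "snd q"] N.commute[of "snd q" y]
          assms in_correspondence[OF p] in_correspondence[OF q] by auto
      moreover have "dM (fst p) (fst q) \<le> dN (snd p) (snd q) + 2 * \<delta>"
        using dis p q \<delta>(2) unfolding distortion_le_def by fastforce
      ultimately show "dM x x' - (dM x (fst p) + \<delta> + dN (snd p) y)
          \<le> dM x' (fst q) + \<delta> + dN (snd q) y"
        by linarith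
    qed
    then show "dM x x' - glue_dist R dM dN \<delta> x' y \<le> dM x (fst p) + \<delta> + dN (snd p) y"
      by linarith
  qed
  then show ?thesis by linarith
qed

lemma dist_le_glue_dist_right:
  assumes "x \<in> M" "y \<in> N" "y' \<in> N"
  shows "dN y y' \<le> glue_dist R dM dN \<delta> x y + glue_dist R dM dN \<delta> x y'"
proof -
  have "dN y y' - glue_dist R dM dN \<delta> x y' \<le> glue_dist R dM dN \<delta> x y"
  proof (rule le_glue_dist[OF \<open>x \<in> M\<close>])
    fix p assume p: "p \<in> R"
    have "dN y y' - (dM x (fst p) + \<delta> + dN (snd p) y) \<le> glue_dist R dM dN \<delta> x y'"
    proof (rule le_glue_dist[OF \<open>x \<in> M\<close>])
      fix q assume q: "q \<in> R"
      have "dN y y' \<le> dN (snd p) y + dN (snd p) (snd q) + dN (snd q) y'"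
        using N.triangle[of y "snd p" y'] N.triangle[of "snd p" "snd q" y'] N.commute[of y "snd p"]
          assms in_correspondence[OF p] in_correspondence[OF q] by auto
      moreover have "dM (fst p) (fst q) \<le> dM x (fst p) + dM x (fst q)"
        using M.triangle[of "fst p" x "fst q"] M.commute[of "fst p" x]
          assms in_correspondence[OF p] in_correspondence[OF q] by auto
      moreover have "dN (snd p) (snd q) \<le> dM (fst p) (fst q) + 2 * \<delta>"
        using dis p q \<delta>(2) unfolding distortion_le_def by fastforce
      ultimately show "dN y y' - (dM x (fst p) + \<delta> + dN (snd p) y)
          \<le> dM x (fst q) + \<delta> + dN (snd q) y'"
        by linarith
    qed
    then show "dN y y' - glue_dist R dM dN \<delta> x y' \<le> dM x (fst p) + \<delta> + dN (snd p) y"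
      by linarith
  qed
  then show ?thesis by linarith
qed

text \<open>Positivity of \<delta> keeps the copies apart, and \<epsilon> \<le>
  \<open>2 * \<delta>\<close> rules out shortcuts through the other copy.\<close>

lemma Metric_space_glue: "Metric_space (Inl ` M \<union> Inr ` N) (glue_metric R dM dN \<delta>)"
proof
  let ?d = "glue_metric R dM dN \<delta>"
  show "0 \<le> ?d u v" for u v
    by (cases u; cases v) (auto simp: glue_dist_def)
  show "?d u v = ?d v u" for u v
    by (cases u; cases v) (auto simp: M.commute N.commute)
  show "(?d u v = 0) = (u = v)" if "u \<in> Inl ` M \<union> Inr ` N" "v \<in> Inl ` M \<union> Inr ` N" for u v
    using that by (auto dest: glue_dist_pos simp: less_imp_neq[OF glue_dist_pos, symmetric])
  show "?d u w \<le> ?d u v + ?d v w"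
    if "u \<in> Inl ` M \<union> Inr ` N" "v \<in> Inl ` M \<union> Inr ` N" "w \<in> Inl ` M \<union> Inr ` N" for u v w
  proof -
    \<comment> \<open>The left and right triangle inequalities again, in the orientation arising
      when the route starts in the copy of \<open>N\<close> and ends in that of
      \<open>M\<close>.\<close>
    have "glue_dist R dM dN \<delta> x y \<le> glue_dist R dM dN \<delta> x' y + dM x' x"
      if "x \<in> M" "x' \<in> M" for x x' y
      using glue_dist_triangle_left[OF that, of y] by (simp add: M.commute add.commute)
    moreover have "glue_dist R dM dN \<delta> x y \<le> dN y y' + glue_dist R dM dN \<delta> x y'"
      if "x \<in> M" "y \<in> N" "y' \<in> N" for x y y'
      using glue_dist_triangle_right[OF that] by (simp add: N.commute add.commute)
    ultimately show ?thesis
      using that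
      by (auto simp: M.triangle N.triangle glue_dist_triangle_left glue_dist_triangle_right
          dist_le_glue_dist_left dist_le_glue_dist_right)
  qed
qed

lemma d_GH_le_of_distortion: "d_GH M dM N dN \<le> ereal \<delta>"
\<comment> \<open>Thickenings are strict, while corresponding points are only known to be at
  distance at most \<delta>; the slack \<open>e\<close> bridges this.\<close>
proof (rule ereal_le_epsilon2)
  fix e :: real assume e: "0 < e"
  let ?Z = "Inl ` M \<union> Inr ` N" and ?d = "glue_metric R dM dN \<delta>"
  have near: "glue_dist R dM dN \<delta> (fst p) (snd p) < \<delta> + e" if "p \<in> R" for p
    using glue_dist_le[OF that, of "fst p" "snd p"] in_correspondence[OF that] e by simp
  have "\<exists>y\<in>N. glue_dist R dM dN \<delta> x y < \<delta> + e" if x: "x \<in> M" for x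
  proof -
    obtain p where "p \<in> R" "x = fst p"
      using x R unfolding correspondence_def by blast
    then show ?thesis
      using near in_correspondence by blast
  qed
  moreover have "\<exists>x\<in>M. glue_dist R dM dN \<delta> x y < \<delta> + e" if y: "y \<in> N" for y
  proof -
    obtain p where "p \<in> R" "y = snd p"
      using y R unfolding correspondence_def by blast
    then show ?thesis
      using near in_correspondence by blast
  qed
  ultimately have "hausdorff_dist ?Z ?d (Inl ` M) (Inr ` N) \<le> ereal (\<delta> + e)"
    unfolding hausdorff_dist_def using \<delta>(1) e
    by (intro Inf_lower) (auto simp: thickening_def)
  moreover have "d_GH M dM N dN \<le> hausdorff_dist ?Z ?d (Inl ` M) (Inr ` N)"
    by (intro d_GH_le Metric_space_glue) (auto simp: isometric_embedding_def)
  ultimately show "d_GH M dM N dN \<le> ereal \<delta> + ereal e"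
    by simp
qed

end

section \<open>Correspondences from Hausdorff closeness\<close>

text \<open>Points are paired when their images are closer than some \<eta> < \<delta>. Hausdorff
  closeness makes both projections surjective, and the triangle inequality in \<open>Z\<close>,
  applied twice, keeps the distortion below \<open>2 * \<eta>\<close>.\<close>

lemma correspondence_of_d_GH_less:
  fixes M :: "'a set" and N :: "'b set"
  assumes "d_GH M dM N dN < ereal \<delta>"
  obtains R where "correspondence M N R"
    "\<And>p q. p \<in> R \<Longrightarrow> q \<in> R \<Longrightarrow> \<bar>dM (fst p) (fst q) - dN (snd p) (snd q)\<bar> < 2 * \<delta>"
proof -
  obtain Z :: "('a + 'b) set" and d i j where "Metric_space Z d"
    and i: "isometric_embedding M dM Z d i" and j: "isometric_embedding N dN Z d j"
    and "hausdorff_dist Z d (i ` M) (j ` N) < ereal \<delta>"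
    using assms unfolding d_GH_def Inf_less_iff by blast
  then obtain \<eta> where "\<eta> < \<delta>"
    and near: "i ` M \<subseteq> thickening Z d (j ` N) \<eta>" "j ` N \<subseteq> thickening Z d (i ` M) \<eta>"
    unfolding hausdorff_dist_def Inf_less_iff by auto
  interpret Metric_space Z d by fact
  define R where "R = {(x, y). x \<in> M \<and> y \<in> N \<and> d (i x) (j y) < \<eta>}"
  show ?thesis
  proof
    have "\<exists>y\<in>N. d (i x) (j y) < \<eta>" if "x \<in> M" for x
      using near(1) that by (auto simp: thickening_def)
    moreover have "\<exists>x\<in>M. d (i x) (j y) < \<eta>" if y: "y \<in> N" for y
    proof -
      obtain x where "x \<in> M" "d (j y) (i x) < \<eta>"
        using near(2) y by (auto simp: thickening_def)
      then show ?thesis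
        by (auto simp: commute[of "j y"])
    qed
    ultimately show "correspondence M N R"
      unfolding correspondence_def R_def by (force simp: image_iff)
  next
    fix p q assume pq: "p \<in> R" "q \<in> R"
    obtain x y x' y' where eq: "p = (x, y)" "q = (x', y')"
      by (cases p, cases q)
    with pq have xy: "x \<in> M" "y \<in> N" "d (i x) (j y) < \<eta>" "x' \<in> M" "y' \<in> N" "d (i x') (j y') < \<eta>"
      by (auto simp: R_def)
    then have Z: "i x \<in> Z" "i x' \<in> Z" "j y \<in> Z" "j y' \<in> Z"
      using i j by (auto simp: isometric_embedding_def)
    have "dM x x' = d (i x) (i x')" "dN y y' = d (j y) (j y')"
      using i j xy by (auto simp: isometric_embedding_def)
    moreover have "d (i x) (i x') \<le> d (i x) (j y) + d (j y) (j y') + d (i x') (j y')"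
      using triangle[OF Z(1,3,2)] triangle[OF Z(3,4,2)] commute[of "i x'" "j y'"] by linarith
    moreover have "d (j y) (j y') \<le> d (i x) (j y) + d (i x) (i x') + d (i x') (j y')"
      using triangle[OF Z(3,1,4)] triangle[OF Z(1,2,4)] commute[of "i x" "j y"] by linarith
    ultimately show "\<bar>dM (fst p) (fst q) - dN (snd p) (snd q)\<bar> < 2 * \<delta>"
      using xy \<open>\<eta> < \<delta>\<close> eq by auto
  qed
qed

lemma d_GH_nonneg: "0 \<le> d_GH M dM N dN"
proof -
  have "0 \<le> hausdorff_dist Z d A B" for Z :: "'c set" and d A B
    unfolding hausdorff_dist_def by (rule Inf_greatest) auto
  then show ?thesis
    unfolding d_GH_def by (intro Inf_greatest) blast
qed

section \<open>The two distances\<close>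

text \<open>The correspondence obtained from the Gromov-Hausdorff bound has a strict distortion
  estimate, as \<open>pullback_cluster_le\<close> requires in each direction.\<close>

lemma d_CI_le:
  assumes H: "ultrametric_hc X I H" and E: "ultrametric_hc Y J E"
    and less: "d_GH X (theta_metric X I H) Y (theta_metric Y J E) < ereal \<delta>"
  shows "d_CI X I H Y J E \<le> ereal (2 * \<delta>)"
proof (rule correspondence_of_d_GH_less[OF less])
  have "0 < ereal \<delta>"
    by (rule le_less_trans[OF d_GH_nonneg less])
  fix R assume R: "correspondence X Y R"
    and dis: "\<And>p q. p \<in> R \<Longrightarrow> q \<in> R \<Longrightarrow>
      \<bar>theta_metric X I H (fst p) (fst q) - theta_metric Y J E (snd p) (snd q)\<bar> < 2 * \<delta>"
  have img: "fst ` R = X" "snd ` R = Y"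
    using R by (auto simp: correspondence_def)
  have "interleaved_wrt R I H J E (2 * \<delta>)"
    unfolding interleaved_wrt_def interleaved_def
  proof (intro allI conjI)
    fix r
    show "hc_extend R I (pullback R fst \<circ> H) r \<preceq> hc_extend R J (pullback R snd \<circ> E) (r + 2 * \<delta>)"
      by (rule pullback_cluster_le[OF H E img]) (use dis in \<open>smt (verit)\<close>)
    show "hc_extend R J (pullback R snd \<circ> E) r \<preceq> hc_extend R I (pullback R fst \<circ> H) (r + 2 * \<delta>)"
      by (rule pullback_cluster_le[OF E H img(2,1)]) (use dis in \<open>smt (verit)\<close>)
  qed
  with R \<open>0 < ereal \<delta>\<close> show ?thesis
    unfolding d_CI_def by (intro Inf_lower) auto
qed

text \<open>The two halves of the interleaving bound the difference of the metrics from both sides.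
  Keeping \<delta> separate from \<open>\<epsilon> / 2\<close> covers \<epsilon> = 0, where gluing
  still needs a positive cost.\<close>

lemma d_GH_le_of_interleaved:
  assumes H: "ultrametric_hc X I H" and E: "ultrametric_hc Y J E"
    and R: "correspondence X Y R" and int: "interleaved_wrt R I H J E \<epsilon>"
    and \<delta>: "0 < \<delta>" "\<epsilon> \<le> 2 * \<delta>"
  shows "d_GH X (theta_metric X I H) Y (theta_metric Y J E) \<le> ereal \<delta>"
proof (rule d_GH_le_of_distortion[OF Metric_space_theta[OF H] Metric_space_theta[OF E] R _ \<delta>])
  note le = int[unfolded interleaved_wrt_def interleaved_def, rule_format]
  show "distortion_le R (theta_metric X I H) (theta_metric Y J E) \<epsilon>"
    unfolding distortion_le_def
  proof (intro ballI)
    fix p q assume pq: "p \<in> R" "q \<in> R"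
    then have "fst p \<in> X" "fst q \<in> X" "snd p \<in> Y" "snd q \<in> Y"
      using R by (auto simp: correspondence_def)
    then show "\<bar>theta_metric X I H (fst p) (fst q) - theta_metric Y J E (snd p) (snd q)\<bar> \<le> \<epsilon>"
      using theta_metric_le_of_pullback_cluster_le[OF H E conjunct1[OF le], of p q]
        theta_metric_le_of_pullback_cluster_le[OF E H conjunct2[OF le], of p q] pq
      by linarith
  qed
qed

theorem proposition21:
  fixes X :: "'a set" and Y :: "'b set"
    and I J :: "real set"
    and H :: "real \<Rightarrow> 'a set set" and E :: "real \<Rightarrow> 'b set set"
  assumes "ultrametric_hc X I H"
    and "ultrametric_hc Y J E"
  shows "d_CI X I H Y J E = 2 * d_GH X (theta_metric X I H) Y (theta_metric Y J E)"
proof (rule antisym)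
  let ?G = "d_GH X (theta_metric X I H) Y (theta_metric Y J E)"
  show "d_CI X I H Y J E \<le> 2 * ?G"
  \<comment> \<open>\<open>d_CI_le\<close> needs a strict bound, so the estimate is made for every
    \<open>c\<close> above the target; only finite \<open>c\<close> is substantial.\<close>
  proof (rule dense_ge)
    fix c assume c: "2 * ?G < c"
    show "d_CI X I H Y J E \<le> c"
    proof (cases c)
      case (real r)
      then have "?G < ereal (r / 2)"
        using c d_GH_nonneg[of X "theta_metric X I H" Y "theta_metric Y J E"]
        by (cases ?G) auto
      from d_CI_le[OF assms this] show ?thesis
        by (simp add: real)
    qed (use c in auto)
  qed
  show "2 * ?G \<le> d_CI X I H Y J E"
    unfolding d_CI_def
  proof (rule Inf_greatest, clarify)
    fix \<epsilon> R assume \<epsilon>: "0 \<le> \<epsilon>" and R: "correspondence X Y R" "interleaved_wrt R I H J E \<epsilon>"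
    show "2 * ?G \<le> ereal \<epsilon>"
    proof (rule ereal_le_epsilon2)
      fix e :: real assume "0 < e"
      \<comment> \<open>Half of \<open>\<epsilon> + e\<close> is an admissible gluing cost:
        positive, and at least \<open>\<epsilon> / 2\<close>.\<close>
      then have "?G \<le> ereal ((\<epsilon> + e) / 2)"
        using \<epsilon> by (intro d_GH_le_of_interleaved[OF assms R]) auto
      then show "2 * ?G \<le> ereal \<epsilon> + ereal e"
        by (cases ?G) auto
    qed
  qed
qed

end
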